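(* Let $n,s_1,s_2$ be integers such that $0\le s_1<s_2<n$, and let $a,b$ be non-zero complex numbers. Then $$\det\left(aP_n^{s_1}+bP_n^{s_2}\right)=(-1)^{(n-1)s_1}\left(a^{\,n\backslash(s_2-s_1)}-(-b)^{\,n\backslash(s_2-s_1)}\right)^{(n,\,s_2-s_1)}.$$ Hence $aP_n^{s_1}+bP_n^{s_2}$ is singular if and only if $a^{\,n\backslash(s_2-s_1)}-(-b)^{\,n\backslash(s_2-s_1)}=0$.
   Context: Matrix indices run over $\{0,1,\dots,n-1\}$. $P_n$ is the $n\times n$ permutation matrix with $(P_n)_{i,j}=1$ if $j\equiv i+1\pmod n$ and $0$ otherwise; $P_n^0=I_n$. $(n,s)$ denotes the greatest common divisor of $n$ and $s$, and $n\backslash s:=n/(n,s)$. *)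

theory Defs
  imports
    Complex_Main
    "HOL-Number_Theory.Cong"
    "Jordan_Normal_Form.Determinant"
begin

text \<open>The matrix $P_n$; rows and columns are indexed by $0, \dots, n-1$.\<close>

definition cyclic_perm_mat :: "nat \<Rightarrow> complex mat" where
  "cyclic_perm_mat n = mat n n (\<lambda>(i, j). if [j = i + 1] (mod n) then 1 else 0)"

text \<open>The operation written $n \backslash s = n/(n,s)$. Natural-number division loses nothing
  here, since the gcd divides \<open>n\<close>.\<close>

definition gcd_quotient :: "nat \<Rightarrow> nat \<Rightarrow> nat" where
  "gcd_quotient n s = n div gcd n s"

definition singular_mat :: "complex mat \<Rightarrow> bool" where
  "singular_mat A \<longleftrightarrow> square_mat A \<and> \<not> invertible_mat A"

end

theory Submission
  imports Defs
begin

text \<open>The Fourier matrix \<open>F = (\<omega>\<^bsup>ij\<^esup>)\<close>, with \<open>\<omega>\<close> a primitive \<open>n\<close>-th root of unity,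
  diagonalises \<open>P\<^sub>n\<close>, so the determinant is the product of
  \<open>a \<omega>\<^bsup>js\<^sub>1\<^esup> + b \<omega>\<^bsup>js\<^sub>2\<^esup> = \<omega>\<^bsup>js\<^sub>1\<^esup> (a - (-b) \<omega>\<^bsup>jd\<^esup>)\<close> over \<open>j < n\<close>, where \<open>d = s\<^sub>2 - s\<^sub>1\<close>.
  As \<open>\<omega>\<^sup>d\<close> is a primitive root of order \<open>m = n/(n,d)\<close>, the second factors run \<open>(n,d)\<close> times
  through the linear factors of \<open>a\<^sup>m - (-b)\<^sup>m\<close>.\<close>

section \<open>Primitive roots of unity and their powers\<close>

text \<open>The order of \<open>z\<close> is exactly \<open>n\<close>; phrased by divisibility, it
  turns every question about powers into arithmetic of exponents. For \<open>n = 0\<close> it says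
  that no positive power of \<open>z\<close> is 1.\<close>

definition primitive_root_unity :: "nat \<Rightarrow> 'a::monoid_mult \<Rightarrow> bool" where
  "primitive_root_unity n z \<longleftrightarrow> (\<forall>k. z ^ k = 1 \<longleftrightarrow> n dvd k)"

lemma primitive_root_unity_power_self:
  "primitive_root_unity n z \<Longrightarrow> z ^ n = 1"
  by (simp add: primitive_root_unity_def)

lemma primitive_root_unity_nonzero:
  fixes z :: "'a::field"
  assumes "primitive_root_unity n z" "n > 0"
  shows "z \<noteq> 0"
  using primitive_root_unity_power_self[OF assms(1)] assms(2) by (auto simp: power_0_left)

lemma primitive_root_unity_inj_on:
  fixes z :: "'a::field"
  assumes z: "primitive_root_unity n z"
  shows "inj_on (\<lambda>j. z ^ j) {..<n}"
proof (rule linorder_inj_onI')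
  fix i j assume ij: "i \<in> {..<n}" "j \<in> {..<n}" "i < j"
  have "z \<noteq> 0" using primitive_root_unity_nonzero[OF z] ij by auto
  \<comment> \<open>The exponent satisfies \<open>0 < j - i < n\<close>, so \<open>n\<close> does
    not divide it.\<close>
  moreover have "z ^ (j - i) \<noteq> 1"
    using z ij by (auto simp: primitive_root_unity_def dest: dvd_imp_le)
  ultimately show "z ^ i \<noteq> z ^ j"
    using ij by (simp add: power_diff)
qed

text \<open>Cancelling \<open>g = gcd n d\<close> from \<open>n dvd d * k\<close> leaves
  \<open>n div g dvd (d div g) * k\<close>, and \<open>d div g\<close> drops out because it is
  coprime to \<open>n div g\<close>.\<close>

lemma primitive_root_unity_power:
  assumes z: "primitive_root_unity n z" and "n > 0"
  shows "primitive_root_unity (n div gcd n d) (z ^ d)"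
  unfolding primitive_root_unity_def
proof
  fix k
  define g where "g = gcd n d"
  have g: "g > 0" "n = g * (n div g)" "d = g * (d div g)"
    using \<open>n > 0\<close> by (simp_all add: g_def)
  have cop: "coprime (n div g) (d div g)"
    unfolding g_def using \<open>n > 0\<close> by (intro div_gcd_coprime) simp
  have "(z ^ d) ^ k = 1 \<longleftrightarrow> n dvd d * k"
    using z by (simp add: primitive_root_unity_def flip: power_mult)
  also have "\<dots> \<longleftrightarrow> g * (n div g) dvd g * (d div g * k)"
    using g by (metis mult.assoc)
  also have "\<dots> \<longleftrightarrow> n div g dvd k"
    using g(1) by (simp add: coprime_dvd_mult_right_iff[OF cop])
  finally show "(z ^ d) ^ k = 1 \<longleftrightarrow> n div gcd n d dvd k" by (simp only: g_def)
qed

lemma primitive_root_unity_cis: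
  assumes n: "n > 0"
  shows "primitive_root_unity n (cis (2 * pi / n))"
  unfolding primitive_root_unity_def
proof
  fix k
  let ?w = "cis (2 * pi / n)"
  have wn: "?w ^ n = 1" using n by (simp add: DeMoivre)
  have "?w ^ k = ?w ^ (n * (k div n) + k mod n)" by simp
  also have "\<dots> = ?w ^ (k mod n)"
    unfolding power_add power_mult wn by simp
  also have "\<dots> = cis (2 * pi * real (k mod n) / real n)"
    by (simp add: DeMoivre mult.commute)
  finally have wk: "?w ^ k = cis (2 * pi * real (k mod n) / real n)" .
  have "?w ^ k = 1 \<longleftrightarrow> cis (2 * pi * real (k mod n) / real n) = cis (2 * pi * real 0 / real n)"
    by (simp add: wk)
  \<comment> \<open>Both \<open>k mod n\<close> and 0 lie below \<open>n\<close>, where distinct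
    indices give distinct roots of unity.\<close>
  also have "\<dots> \<longleftrightarrow> k mod n = 0"
    using inj_on_eq_iff[OF bij_betw_imp_inj_on[OF bij_betw_roots_unity[OF n]], of "k mod n" 0] n
    by simp
  finally show "?w ^ k = 1 \<longleftrightarrow> n dvd k" by (simp add: dvd_eq_mod_eq_0)
qed

section \<open>Products over the powers of a primitive root\<close>

text \<open>This is the factorisation of X^m - 1 into linear factors, evaluated at
  \<open>x / y\<close> and multiplied by \<open>y ^ m\<close>; hence the separate case
  \<open>y = 0\<close>.\<close>

lemma prod_linear_primitive_root_unity:
  fixes x y z :: "'a::field"
  assumes z: "primitive_root_unity m z" and m: "m > 0"
  shows "(\<Prod>j<m. x - y * z ^ j) = x ^ m - y ^ m"
proof (cases "y = 0")
  case True
  then show ?thesis using m by simp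
next
  case False
  let ?p = "\<Prod>j<m. [:- (z ^ j), 1:]" and ?q = "monom 1 m - 1 :: 'a poly"
  have deg_p: "degree ?p = m" by (subst degree_prod_sum_eq) auto
  have deg_q: "degree ?q \<le> m" by (intro degree_diff_le degree_monom_le) auto
  have "?p = ?q"
  \<comment> \<open>Polynomials of degree at most \<open>m\<close> with equal coefficient at
    \<open>m\<close> coincide once they agree at \<open>m\<close> points, here the distinct powers
    of \<open>z\<close>.\<close>
  proof (rule poly_eqI_degree_lead_coeff[where n = m and A = "(\<lambda>j. z ^ j) ` {..<m}"])
    have "coeff ?p m = 1"
      using lead_coeff_prod[of "\<lambda>j. [:- (z ^ j), 1:]" "{..<m}"] deg_p by simp
    \<comment> \<open>Since \<open>m > 0\<close>, the constant 1 in \<open>?q\<close> does not touch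
      this coefficient.\<close>
    then show "coeff ?p m = coeff ?q m" using m by simp
  next
    fix u assume "u \<in> (\<lambda>j. z ^ j) ` {..<m}"
    then obtain j where j: "j < m" "u = z ^ j" by auto
    have "u ^ m = 1"
      using z by (simp add: j primitive_root_unity_def flip: power_mult)
    then have "poly ?q u = 0" by (simp add: poly_monom)
    moreover have "poly ?p u = 0" using j by (auto simp: poly_prod)
    ultimately show "poly ?p u = poly ?q u" by simp
  qed (use deg_p deg_q card_image[OF primitive_root_unity_inj_on[OF z]] in auto)
  then have "poly ?p (x / y) = poly ?q (x / y)" by simp
  then have eq: "(\<Prod>j<m. x / y - z ^ j) = (x / y) ^ m - 1"
    by (simp add: poly_prod poly_monom)
  have "(\<Prod>j<m. x - y * z ^ j) = (\<Prod>j<m. y * (x / y - z ^ j))"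
    using False by (simp add: right_diff_distrib)
  also have "\<dots> = y ^ m * ((x / y) ^ m - 1)" by (simp add: prod.distrib eq)
  finally show ?thesis using False by (simp add: right_diff_distrib power_divide)
qed

lemma prod_powers_primitive_root_unity:
  fixes z :: "'a::field"
  assumes z: "primitive_root_unity n z" and n: "n > 0"
  shows "(\<Prod>j<n. z ^ j) = (- 1) ^ (n - 1)"
proof -
  \<comment> \<open>One of the two signs is absorbed into the factors, which gives the linear
    product at \<open>x = 0\<close>, \<open>y = 1\<close>.\<close>
  have "(\<Prod>j<n. z ^ j) = (- 1) ^ n * ((- 1) ^ n * (\<Prod>j<n. z ^ j))"
    by simp
  also have "(- 1) ^ n * (\<Prod>j<n. z ^ j) = (\<Prod>j<n. 0 - 1 * z ^ j)"
    by (simp add: prod_uminus)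
  also have "\<dots> = - 1"
    using n by (simp only: prod_linear_primitive_root_unity[OF z n]) simp
  finally show ?thesis using n by (cases n) simp_all
qed

text \<open>The range splits into \<open>g\<close> consecutive blocks of length \<open>m\<close>,
  each a shift of the first.\<close>

lemma prod_lessThan_mult_periodic:
  fixes f :: "nat \<Rightarrow> 'a::comm_monoid_mult"
  assumes "\<And>j. f (j + m) = f j"
  shows "(\<Prod>j<g * m. f j) = (\<Prod>j<m. f j) ^ g"
proof -
  have shift: "f (j + i * m) = f j" for i j
    by (induction i) (simp_all add: assms add.assoc[symmetric] add.commute[of m])
  have "(\<Prod>j<g * m. f j) = (\<Prod>i<g. \<Prod>j\<in>{i * m..<i * m + m}. f j)"
    by (rule prod.nat_group[symmetric])
  also have "\<dots> = (\<Prod>i<g. \<Prod>j<m. f j)"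
  proof (rule prod.cong[OF refl])
    fix i
    show "prod f {i * m..<i * m + m} = prod f {..<m}"
      using prod.shift_bounds_nat_ivl[of f 0 "i * m" m]
      by (simp add: shift add.commute atLeast0LessThan)
  qed
  finally show ?thesis by simp
qed

section \<open>Diagonal determinants and the determinant criterion for invertibility\<close>

lemma det_mat_diag: "det (mat_diag n f) = (\<Prod>j<n. f j)"
proof -
  have "det (mat_diag n f) = prod_list (diag_mat (mat_diag n f))"
    by (rule det_upper_triangular[of _ n]) (auto simp: mat_diag_def)
  also have "\<dots> = (\<Prod>j<n. f j)"
    by (simp add: prod_list_diag_prod mat_diag_def atLeast0LessThan)
  finally show ?thesis .
qed

lemma invertible_mat_iff_det_nonzero:
  fixes A :: "'a::field mat"
  assumes A: "A \<in> carrier_mat n n"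
  shows "invertible_mat A \<longleftrightarrow> det A \<noteq> 0"
proof
  assume "invertible_mat A"
  then obtain B where AB: "A * B = 1\<^sub>m n" and BA: "B * A = 1\<^sub>m (dim_row B)"
    using A by (auto simp: invertible_mat_def inverts_mat_def)
  \<comment> \<open>The definition of invertibility does not fix the size of \<open>B\<close>; it is
    read off from the columns of the two products.\<close>
  have "dim_col (A * B) = n" "dim_col (B * A) = dim_row B"
    by (simp_all only: AB BA index_one_mat)
  then have B: "B \<in> carrier_mat n n" using A by auto
  have "det A * det B = 1" using det_mult[OF A B] AB by simp
  then show "det A \<noteq> 0" by auto
next
  assume "det A \<noteq> 0"
  from det_non_zero_imp_unit[OF A this, of "()"]
  show "invertible_mat A"
    using A by (auto simp: Units_def ring_mat_def invertible_mat_def inverts_mat_def)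
qed

section \<open>The Fourier matrix\<close>

definition fourier_mat :: "nat \<Rightarrow> 'a::monoid_mult \<Rightarrow> 'a mat" where
  "fourier_mat n w = mat n n (\<lambda>(i, j). w ^ (i * j))"

lemma fourier_mat_carrier [simp]: "fourier_mat n w \<in> carrier_mat n n"
  by (simp add: fourier_mat_def)

text \<open>The matrix with entries \<open>inverse w ^ (i * j)\<close>, scaled by 1/n, is a right
  inverse, by orthogonality of the rows.\<close>

lemma det_fourier_mat_nonzero:
  fixes w :: "'a::field_char_0"
  assumes w: "primitive_root_unity n w"
  shows "det (fourier_mat n w) \<noteq> 0"
proof -
  let ?F = "fourier_mat n w"
  define G where "G = mat n n (\<lambda>(i, j). inverse (of_nat n) * inverse w ^ (i * j))"
  have G: "G \<in> carrier_mat n n" by (simp add: G_def)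
  have "?F * G = 1\<^sub>m n"
  proof (rule eq_matI)
    fix i j assume "i < dim_row (1\<^sub>m n :: 'a mat)" "j < dim_col (1\<^sub>m n :: 'a mat)"
    then have ij: "i < n" "j < n" by auto
    then have w0: "w \<noteq> 0" using primitive_root_unity_nonzero[OF w] by auto
    \<comment> \<open>Entry \<open>(i, j)\<close> of the product becomes a geometric sum in
      \<open>u\<close>; as \<open>u ^ n = 1\<close>, it vanishes unless \<open>u = 1\<close>, that
      is, unless \<open>i = j\<close>.\<close>
    define u where "u = w ^ i / w ^ j"
    have "(?F * G) $$ (i, j) = (\<Sum>k<n. w ^ (i * k) * (inverse (of_nat n) * inverse w ^ (k * j)))"
      using ij by (simp add: fourier_mat_def G_def scalar_prod_def atLeast0LessThan)
    also have "\<dots> = (\<Sum>k<n. inverse (of_nat n) * u ^ k)"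
      by (intro sum.cong refl)
        (simp add: u_def divide_inverse power_mult_distrib power_inverse mult_ac flip: power_mult)
    also have "\<dots> = inverse (of_nat n) * (\<Sum>k<n. u ^ k)" by (simp add: sum_distrib_left)
    also have "\<dots> = (if i = j then 1 else 0)"
    proof (cases "i = j")
      case True
      then show ?thesis using w0 ij by (simp add: u_def)
    next
      case False
      then have "u \<noteq> 1"
        using w0 ij inj_onD[OF primitive_root_unity_inj_on[OF w], of i j] by (auto simp: u_def)
      moreover have "w ^ (k * n) = 1" for k
        using w by (simp add: primitive_root_unity_def)
      then have "u ^ n = 1" by (simp add: u_def power_divide flip: power_mult)
      ultimately show ?thesis using False by (simp add: geometric_sum)
    qed
    finally show "(?F * G) $$ (i, j) = 1\<^sub>m n $$ (i, j)" using ij by simp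
  qed (simp_all add: fourier_mat_def G_def)
  then have "det ?F * det G = 1" using det_mult[OF fourier_mat_carrier G, of w] by simp
  then show ?thesis by auto
qed

section \<open>Diagonalisation of the cyclic permutation matrix\<close>

lemma cyclic_perm_mat_carrier [simp]: "cyclic_perm_mat n \<in> carrier_mat n n"
  by (simp add: cyclic_perm_mat_def)

text \<open>Column \<open>j\<close> of the Fourier matrix is an eigenvector for the eigenvalue
  \<open>w ^ j\<close>: the permutation moves each index up by one, and \<open>w ^ n = 1\<close>
  absorbs the wrap-around.\<close>

lemma cyclic_perm_mat_mult_fourier:
  assumes w: "w ^ n = 1"
  shows "cyclic_perm_mat n * fourier_mat n w = fourier_mat n w * mat_diag n (\<lambda>j. w ^ j)"
proof (rule eq_matI)
  fix i j
  assume "i < dim_row (fourier_mat n w * mat_diag n (\<lambda>j. w ^ j))"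
    "j < dim_col (fourier_mat n w * mat_diag n (\<lambda>j. w ^ j))"
  then have ij: "i < n" "j < n" by (auto simp: fourier_mat_def mat_diag_def)
  have "(cyclic_perm_mat n * fourier_mat n w) $$ (i, j) =
      (\<Sum>k<n. (if [k = i + 1] (mod n) then 1 else 0) * w ^ (k * j))"
    using ij by (simp add: cyclic_perm_mat_def fourier_mat_def scalar_prod_def atLeast0LessThan)
  also have "\<dots> = (\<Sum>k<n. if k = (i + 1) mod n then w ^ (k * j) else 0)"
    by (intro sum.cong) (auto simp: cong_def)
  also have "\<dots> = w ^ (((i + 1) mod n) * j)" using ij by simp
  \<comment> \<open>A multiple of \<open>n\<close> is added to the exponent to undo the reduction of
    \<open>i + 1\<close> modulo \<open>n\<close>.\<close>
  also have "\<dots> = w ^ (n * ((i + 1) div n) * j + ((i + 1) mod n) * j)"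
    using w by (simp add: power_add power_mult)
  also have "\<dots> = w ^ ((i + 1) * j)"
    by (simp only: add_mult_distrib[symmetric] mult_div_mod_eq)
  also have "\<dots> = (fourier_mat n w * mat_diag n (\<lambda>j. w ^ j)) $$ (i, j)"
    using ij by (subst mat_diag_mult_right[of _ n])
      (auto simp: fourier_mat_def power_add mult.commute)
  finally show "(cyclic_perm_mat n * fourier_mat n w) $$ (i, j) =
      (fourier_mat n w * mat_diag n (\<lambda>j. w ^ j)) $$ (i, j)" .
qed (auto simp: fourier_mat_def mat_diag_def cyclic_perm_mat_def)

lemma cyclic_perm_mat_power_mult_fourier:
  assumes w: "w ^ n = 1"
  shows "cyclic_perm_mat n ^\<^sub>m s * fourier_mat n w = fourier_mat n w * mat_diag n (\<lambda>j. w ^ (j * s))"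
proof (induction s)
  case 0
  show ?case
    using left_mult_one_mat[OF fourier_mat_carrier[of n w]]
      right_mult_one_mat[OF fourier_mat_carrier[of n w]]
    by (simp add: cyclic_perm_mat_def)
next
  case (Suc s)
  let ?P = "cyclic_perm_mat n" and ?F = "fourier_mat n w"
  let ?D = "\<lambda>s. mat_diag n (\<lambda>j. w ^ (j * s))"
  have P: "?P ^\<^sub>m s \<in> carrier_mat n n" by (simp add: pow_carrier_mat)
  have "?P ^\<^sub>m Suc s * ?F = ?P ^\<^sub>m s * (?P * ?F)"
    using assoc_mult_mat[OF P cyclic_perm_mat_carrier fourier_mat_carrier] by simp
  also have "\<dots> = ?P ^\<^sub>m s * ?F * ?D 1"
    using assoc_mult_mat[OF P fourier_mat_carrier mat_diag_dim]
    by (simp add: cyclic_perm_mat_mult_fourier[OF w])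
  also have "\<dots> = ?F * (?D s * ?D 1)"
    unfolding Suc.IH by (rule assoc_mult_mat[OF fourier_mat_carrier mat_diag_dim mat_diag_dim])
  also have "?D s * ?D 1 = ?D (Suc s)"
    by (simp add: power_add mult.commute)
  finally show ?case .
qed

text \<open>Both powers have the columns of the Fourier matrix as common eigenvectors, so their
  combination does too. Comparing determinants and cancelling that of the Fourier matrix leaves the
  product of eigenvalues.\<close>

lemma det_cyclic_perm_mat_binomial:
  assumes w: "primitive_root_unity n w"
  shows "det (a \<cdot>\<^sub>m (cyclic_perm_mat n ^\<^sub>m s) + b \<cdot>\<^sub>m (cyclic_perm_mat n ^\<^sub>m t)) =
    (\<Prod>j<n. a * w ^ (j * s) + b * w ^ (j * t))"
proof -
  let ?P = "cyclic_perm_mat n" and ?F = "fourier_mat n w"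
  let ?D = "\<lambda>s. mat_diag n (\<lambda>j. w ^ (j * s))"
  let ?M = "a \<cdot>\<^sub>m (?P ^\<^sub>m s) + b \<cdot>\<^sub>m (?P ^\<^sub>m t)"
  let ?E = "mat_diag n (\<lambda>j. a * w ^ (j * s) + b * w ^ (j * t))"
  note F = fourier_mat_carrier[of n w]
  have P: "?P ^\<^sub>m k \<in> carrier_mat n n" for k by (simp add: pow_carrier_mat)
  have PF: "?P ^\<^sub>m k * ?F = ?F * ?D k" for k
    by (rule cyclic_perm_mat_power_mult_fourier[OF primitive_root_unity_power_self[OF w]])
  have M: "?M \<in> carrier_mat n n" using P by simp
  have "?M * ?F = a \<cdot>\<^sub>m (?P ^\<^sub>m s * ?F) + b \<cdot>\<^sub>m (?P ^\<^sub>m t * ?F)"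
    using add_mult_distrib_mat[OF smult_carrier_mat[OF P] smult_carrier_mat[OF P] F]
    by (simp only: mult_smult_assoc_mat[OF P F])
  also have "\<dots> = ?F * ?E"
    unfolding PF mat_diag_mult_right[OF F]
    by (rule eq_matI) (auto simp: algebra_simps)
  finally have "det (?M * ?F) = det (?F * ?E)" by simp
  then have "det ?M * det ?F = det ?F * det ?E"
    using det_mult[OF M F] det_mult[OF F mat_diag_dim] by simp
  then have "det ?M = det ?E" using det_fourier_mat_nonzero[OF w] by simp
  then show ?thesis by (simp add: det_mat_diag)
qed

theorem corollary4p3:
  fixes n s\<^sub>1 s\<^sub>2 :: nat and a b :: complex
  assumes "s\<^sub>1 < s\<^sub>2" and "s\<^sub>2 < n" and "a \<noteq> 0" and "b \<noteq> 0"
  shows "det (a \<cdot>\<^sub>m (cyclic_perm_mat n ^\<^sub>m s\<^sub>1) + b \<cdot>\<^sub>m (cyclic_perm_mat n ^\<^sub>m s\<^sub>2)) =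
           (- 1) ^ ((n - 1) * s\<^sub>1) *
           (a ^ gcd_quotient n (s\<^sub>2 - s\<^sub>1) - (- b) ^ gcd_quotient n (s\<^sub>2 - s\<^sub>1)) ^ gcd n (s\<^sub>2 - s\<^sub>1)
       \<and> (singular_mat (a \<cdot>\<^sub>m (cyclic_perm_mat n ^\<^sub>m s\<^sub>1) + b \<cdot>\<^sub>m (cyclic_perm_mat n ^\<^sub>m s\<^sub>2)) \<longleftrightarrow>
           a ^ gcd_quotient n (s\<^sub>2 - s\<^sub>1) - (- b) ^ gcd_quotient n (s\<^sub>2 - s\<^sub>1) = 0)"
proof -
  define d where "d = s\<^sub>2 - s\<^sub>1"
  define g where "g = gcd n d"
  define m where "m = gcd_quotient n d"
  define w where "w = cis (2 * pi / n)"
  let ?M = "a \<cdot>\<^sub>m (cyclic_perm_mat n ^\<^sub>m s\<^sub>1) + b \<cdot>\<^sub>m (cyclic_perm_mat n ^\<^sub>m s\<^sub>2)"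
  have n: "n > 0" using assms by simp
  have s2: "s\<^sub>2 = s\<^sub>1 + d" using assms by (simp add: d_def)
  have gm: "n = g * m" by (simp add: g_def m_def gcd_quotient_def)
  have g0: "g > 0" and m0: "m > 0" using n gm by auto
  have w: "primitive_root_unity n w"
    unfolding w_def by (rule primitive_root_unity_cis[OF n])
  have wd: "primitive_root_unity m (w ^ d)"
    unfolding m_def gcd_quotient_def by (rule primitive_root_unity_power[OF w n])
  have "det ?M = (\<Prod>j<n. a * w ^ (j * s\<^sub>1) + b * w ^ (j * s\<^sub>2))"
    by (rule det_cyclic_perm_mat_binomial[OF w])
  also have "\<dots> = (\<Prod>j<n. (w ^ j) ^ s\<^sub>1 * (a - (- b) * (w ^ d) ^ j))"
    by (intro prod.cong refl)
      (simp add: s2 algebra_simps power_add flip: power_mult)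
  also have "\<dots> = (\<Prod>j<n. w ^ j) ^ s\<^sub>1 * (\<Prod>j<n. a - (- b) * (w ^ d) ^ j)"
    by (simp add: prod.distrib prod_power_distrib)
  \<comment> \<open>The factors have period \<open>m\<close> in \<open>j\<close> because
    \<open>(w ^ d) ^ m = 1\<close>, and \<open>n = g * m\<close>.\<close>
  also have "(\<Prod>j<n. a - (- b) * (w ^ d) ^ j) = (\<Prod>j<m. a - (- b) * (w ^ d) ^ j) ^ g"
    unfolding gm
    by (rule prod_lessThan_mult_periodic)
      (simp add: power_add primitive_root_unity_power_self[OF wd])
  also have "(\<Prod>j<m. a - (- b) * (w ^ d) ^ j) = a ^ m - (- b) ^ m"
    by (rule prod_linear_primitive_root_unity[OF wd m0])
  also have "(\<Prod>j<n. w ^ j) ^ s\<^sub>1 = (- 1) ^ ((n - 1) * s\<^sub>1)"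
    by (simp add: prod_powers_primitive_root_unity[OF w n] power_mult)
  finally have det: "det ?M = (- 1) ^ ((n - 1) * s\<^sub>1) * (a ^ m - (- b) ^ m) ^ g" .
  have M: "?M \<in> carrier_mat n n" by (simp add: pow_carrier_mat)
  have "square_mat ?M" using M by (metis carrier_matD square_mat.simps)
  then have "singular_mat ?M \<longleftrightarrow> det ?M = 0"
    by (simp only: singular_mat_def invertible_mat_iff_det_nonzero[OF M]) simp
  \<comment> \<open>The sign is nonzero, and as \<open>g > 0\<close> the power vanishes exactly when
    its base does.\<close>
  also have "\<dots> \<longleftrightarrow> a ^ m - (- b) ^ m = 0" using g0 by (simp add: det)
  finally show ?thesis using det unfolding m_def g_def d_def by blast
qed

end
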